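(* There exists a measurable exponent $p:[0,1]\to[1,+\infty)$ with $1<p_-\le p_+<\infty$ and $1/p(\cdot)\in BLO^{1/\log}$ such that exactly one of the following two asymptotic estimates holds uniformly for all intervals $Q\subset[0,1]$: $$\|\chi_Q\|_{p(\cdot)}\asymp |Q|^{\frac{1}{|Q|}\int_Q\frac{1}{p(x)}\,dx},\qquad \|\chi_Q\|_{p'(\cdot)}\asymp |Q|^{\frac{1}{|Q|}\int_Q\frac{1}{p'(x)}\,dx}.$$
   Context: For a measurable function (exponent) $p:[0,1]\to[1,+\infty)$, $L^{p(\cdot)}[0,1]$ is the set of measurable functions $f$ on $[0,1]$ such that $\int_{[0,1]}(|f(x)|/\lambda)^{p(x)}dx<\infty$ for some $\lambda>0$, with norm $\|f\|_{p(\cdot)}=\inf\{\lambda>0:\int_{[0,1]}(|f(x)|/\lambda)^{p(x)}dx\le 1\}$. Write $p_-=\operatorname{ess\,inf}_{x\in[0,1]}p(x)$ and $p_+=\operatorname{ess\,sup}_{x\in[0,1]}p(x)$. The conjugate exponent is $p'(x)=p(x)/(p(x)-1)$, and $\|\cdot\|_{p'(\cdot)}$ is the norm defined in the same way with $p'$ in place of $p$. Here $\chi_Q$ is the characteristic function of $Q$, $|Q|$ is the Lebesgue measure of $Q$, and intervals are nondegenerate (of positive length). An estimate $A_Q\asymp B_Q$ holds uniformly for all intervals $Q\subset[0,1]$ if there are constants $c,C>0$ independent of $Q$ with $cB_Q\le A_Q\le CB_Q$ for all such $Q$. For $f\in L^1[0,1]$ put $\eta(f,r)=\sup_{|Q|\le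 r}\left(f_Q-\operatorname{ess\,inf}_{x\in Q}f(x)\right)$ for $0<r\le 1$, where the supremum is over all intervals $Q\subset[0,1]$ with $|Q|\le r$ and $f_Q=\frac{1}{|Q|}\int_Q f(x)\,dx$. We say $f\in BLO^{1/\log}$ if there is a constant $C>0$ such that $\eta(f,r)\le C/\log(e+1/r)$ for all $0<r\le1$. *)

theory Defs
  imports "HOL-Analysis.Analysis" "HOL-Probability.Essential_Supremum"
begin

text \<open>Functions on \<open>[0,1]\<close> are functions on \<open>real\<close> of which only the restriction to
  \<open>{0..1}\<close> is ever used; measurability is Lebesgue measurability.\<close>

text \<open>Extended-real valued, so that functions unbounded below get \<open>-\<infinity>\<close>. This is the counterpart
  of \<open>esssup\<close>, cf. \<open>esssup_eq_AE\<close>.\<close>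

definition essinf :: "real measure \<Rightarrow> (real \<Rightarrow> real) \<Rightarrow> ereal" where
  "essinf M f = Sup {z. AE x in M. z \<le> ereal (f x)}"

definition unit_subinterval :: "real set \<Rightarrow> bool" where
  "unit_subinterval Q \<longleftrightarrow> is_interval Q \<and> Q \<subseteq> {0..1} \<and> 0 < measure lebesgue Q"

definition avg :: "(real \<Rightarrow> real) \<Rightarrow> real set \<Rightarrow> real" where
  "avg f Q = 1 / measure lebesgue Q * (LINT x|lebesgue_on Q. f x)"

text \<open>The modular is a nonnegative Lebesgue integral with values in \<open>[0,\<infinity>]\<close>. The norm is meaningful
  for \<open>f \<in> L\<^bsup>p(\<cdot>)\<^esup>[0,1]\<close>, where the set below is nonempty.\<close>

definition modular :: "(real \<Rightarrow> real) \<Rightarrow> (real \<Rightarrow> real) \<Rightarrow> ennreal" where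
  "modular p f = (\<integral>\<^sup>+ x. ennreal (\<bar>f x\<bar> powr p x) \<partial>lebesgue_on {0..1})"

definition var_norm :: "(real \<Rightarrow> real) \<Rightarrow> (real \<Rightarrow> real) \<Rightarrow> real" where
  "var_norm p f = Inf {l. 0 < l \<and> modular p (\<lambda>x. f x / l) \<le> 1}"

text \<open>At points with \<open>p x = 1\<close> division by zero gives \<open>0\<close> instead of \<open>\<infinity>\<close>; when the essential
  infimum of \<open>p\<close> exceeds \<open>1\<close> these points form a null set.\<close>

definition conj_exp :: "(real \<Rightarrow> real) \<Rightarrow> real \<Rightarrow> real" where
  "conj_exp p x = p x / (p x - 1)"

text \<open>The difference is never \<open>\<infinity> - \<infinity>\<close> for integrable \<open>f\<close>: the average is finite.\<close>

definition blo_eta :: "(real \<Rightarrow> real) \<Rightarrow> real \<Rightarrow> ereal" where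
  "blo_eta f r =
     (SUP Q \<in> {Q. unit_subinterval Q \<and> measure lebesgue Q \<le> r}.
        ereal (avg f Q) - essinf (lebesgue_on Q) f)"

definition BLO_inv_log :: "(real \<Rightarrow> real) set" where
  "BLO_inv_log = {f. integrable (lebesgue_on {0..1}) f \<and>
     (\<exists>C>0. \<forall>r. 0 < r \<and> r \<le> 1 \<longrightarrow> blo_eta f r \<le> ereal (C / ln (exp 1 + 1 / r)))}"

definition uniformly_asymp :: "(real set \<Rightarrow> real) \<Rightarrow> (real set \<Rightarrow> real) \<Rightarrow> bool" where
  "uniformly_asymp A B \<longleftrightarrow>
     (\<exists>c C. 0 < c \<and> 0 < C \<and> (\<forall>Q. unit_subinterval Q \<longrightarrow> c * B Q \<le> A Q \<and> A Q \<le> C * B Q))"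

definition char_norm_estimate :: "(real \<Rightarrow> real) \<Rightarrow> bool" where
  "char_norm_estimate p \<longleftrightarrow>
     uniformly_asymp (\<lambda>Q. var_norm p (indicat_real Q))
       (\<lambda>Q. measure lebesgue Q powr avg (\<lambda>x. 1 / p x) Q)"

end

theory Submission
  imports Defs
begin

text \<open>
  Write \<open>q = 1/p\<close>, let \<open>q\<^sub>Q\<close> be the average of \<open>q\<close> over \<open>Q\<close> and put \<open>L = ln (1/|Q|)\<close>. Testing the norm
  of \<open>\<chi>\<^sub>Q\<close> against \<open>|Q|\<close> to the power \<open>q\<^sub>Q\<close> amounts to estimating the average over \<open>Q\<close> of
  \<open>exp (L p(x) (q\<^sub>Q - q(x)))\<close>, see \<open>rescaled_powr_eq\<close>. The condition \<open>q \<in> BLO\<close> with logarithmic decay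
  bounds \<open>L (q\<^sub>Q - q(x))\<close> from above, so this average is bounded, and the elementary
  \<open>exp y \<ge> 1 + y\<close> bounds it from below. Hence the estimate holds for every bounded such \<open>p\<close>
  (\<open>char_norm_estimate_if_BLO_inv_log\<close>), and the point is to make the one for \<open>p'\<close> fail.

  For \<open>p'\<close> the sign in the exponent is reversed, and the relevant quantity is the average of
  \<open>exp (L p'(x) (q(x) - q\<^sub>Q))\<close>. Membership in BLO controls only averages of \<open>L \<bar>q - q\<^sub>Q\<bar>\<close>, and
  the exponential average can be unbounded if \<open>q\<close> rises fast enough on a small part of \<open>Q\<close>.

  The exponent is sought in the form \<open>q(x) = 1/4 + \<phi> (ln (1 + t))\<close> with \<open>t = ln (1/x)\<close>. If \<open>\<phi>\<close>
  is increasing, bounded and Lipschitz, then \<open>q\<close> lies in the BLO class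
  (\<open>shifted_profile_in_BLO_inv_log\<close>), since the worst intervals are those with left end \<open>0\<close> and there
  the average of \<open>ln (|Q|/x)\<close> is a constant. The Lipschitz bound permits \<open>q\<close> to grow in \<open>t\<close> with
  slope of order \<open>1/L\<close> near \<open>t = L\<close>. If it does so along a stretch \<open>[L, L + M]\<close> with slope at least
  \<open>2/L\<close>, then on the part \<open>x \<le> exp (- L - M)\<close> of \<open>Q = [0, exp (- L)]\<close> the exponential is about
  \<open>exp (2M)\<close>, while that part is the fraction \<open>exp (- M)\<close> of \<open>Q\<close>. The average is at least about
  \<open>exp M\<close>, so the estimate for \<open>p'\<close> fails as soon as \<open>M\<close> is unbounded
  (\<open>steep_profile_not_char_norm_estimate\<close>).

  Such stretches raise \<open>q\<close> by an amount of order \<open>M/L\<close> each, which is summable if \<open>L\<close> grows much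
  faster than \<open>M\<close>. The function \<open>stair\<close> realizes this: a staircase whose rises have height of order \<open>2\<^sup>-\<^sup>k\<close> near
  \<open>L \<approx> exp (2k)\<close>, so that \<open>M\<close> tends to infinity while the total height stays below \<open>1/4\<close>.
\<close>

section \<open>Subintervals, averages and the modular\<close>

lemma unit_subinterval_endpoints:
  assumes "unit_subinterval Q"
  obtains a b where "0 \<le> a" "a < b" "b \<le> 1" "{a<..<b} \<subseteq> Q" "Q \<subseteq> {a..b}"
    "Q \<in> sets lebesgue" "measure lebesgue Q = b - a"
proof -
  have Q: "is_interval Q" "Q \<subseteq> {0..1}" "0 < measure lebesgue Q"
    using assms by (auto simp: unit_subinterval_def)
  have ne: "Q \<noteq> {}" using Q(3) by auto
  have bb: "bdd_below Q" "bdd_above Q" using Q(2) by (meson bdd_above_Icc bdd_above_mono bdd_below_Icc bdd_below_mono)+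
  define a b where "a = Inf Q" and "b = Sup Q"
  have sub: "Q \<subseteq> {a..b}"
    using bb by (auto simp: a_def b_def intro: cInf_lower cSup_upper)
  have sup: "{a<..<b} \<subseteq> Q"
  proof
    fix x assume "x \<in> {a<..<b}"
    then obtain y z where "y \<in> Q" "y < x" "z \<in> Q" "x < z"
      using ne bb by (auto simp: a_def b_def cInf_less_iff less_cSup_iff)
    then show "x \<in> Q" using Q(1) unfolding is_interval_1 by (meson less_imp_le)
  qed
  have lmeas: "Q \<in> lmeasurable"
    using Q(1,2) by (intro measurable_convex) 
      (auto simp: is_interval_convex intro: bounded_subset[OF bounded_closed_interval])
  then have meas: "Q \<in> sets lebesgue"
    by (rule fmeasurableD)
  have ab: "0 \<le> a" "b \<le> 1"
    using ne Q(2) by (auto simp: a_def b_def intro!: cInf_greatest cSup_least)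
  have le: "a \<le> b" using ne sub by fastforce
  have mQ: "measure lebesgue Q = b - a"
  proof (rule antisym)
    have "measure lebesgue Q \<le> measure lebesgue {a..b}"
      by (rule measure_mono_fmeasurable[OF sub meas]) simp
    then show "measure lebesgue Q \<le> b - a" using le by simp
    have "measure lebesgue {a<..<b} \<le> measure lebesgue Q"
      by (rule measure_mono_fmeasurable[OF sup _ lmeas]) simp
    then show "b - a \<le> measure lebesgue Q" using le by simp
  qed
  then have "a < b" using Q(3) by simp
  then show ?thesis using that ab sub sup meas mQ by blast
qed

lemma essinf_ge:
  assumes "AE x in M. c \<le> f x"
  shows "ereal c \<le> essinf M f"
  unfolding essinf_def using assms by (intro Sup_upper) auto

lemma modular_indicator:
  assumes "Q \<in> sets lebesgue" "Q \<subseteq> {0..1}" "0 < l"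
  shows "modular p (\<lambda>x. indicat_real Q x / l) = (\<integral>\<^sup>+ x. ennreal (l powr (- p x)) \<partial>lebesgue_on Q)"
proof -
  have "modular p (\<lambda>x. indicat_real Q x / l)
      = (\<integral>\<^sup>+ x. ennreal (\<bar>indicat_real Q x / l\<bar> powr p x) * indicator {0..1} x \<partial>lebesgue)"
    unfolding modular_def by (subst nn_integral_restrict_space) auto
  also have "\<dots> = (\<integral>\<^sup>+ x. ennreal (l powr (- p x)) * indicator Q x \<partial>lebesgue)"
    using assms by (intro nn_integral_cong)
      (auto simp: indicator_def powr_minus powr_divide divide_simps)
  also have "\<dots> = (\<integral>\<^sup>+ x. ennreal (l powr (- p x)) \<partial>lebesgue_on Q)"
    using assms by (subst nn_integral_restrict_space) auto
  finally show ?thesis .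
qed

text \<open>With \<open>v = |Q|\<close> and \<open>s\<close> the average of \<open>1/p\<close>, the left-hand side is the integrand of the modular
  of \<open>\<chi>\<^sub>Q / \<lambda>\<close> for the candidate \<open>\<lambda> = exp \<kappa> \<cdot> v\<^sup>s\<close>. The factor \<open>1/v\<close> normalizes the integral to an
  average, so only the deviation \<open>s - 1/p\<close>, magnified by \<open>ln (1/v)\<close>, matters.\<close>

lemma rescaled_powr_eq:
  fixes v s p \<kappa> :: real
  assumes "0 < v" "p \<noteq> 0"
  shows "(exp \<kappa> * v powr s) powr (- p) = exp (p * (- ln v * (s - 1 / p) - \<kappa>)) / v"
proof -
  have "exp (p * (- ln v * (s - 1 / p) - \<kappa>)) / v
      = exp (p * (- ln v * (s - 1 / p) - \<kappa>) - ln v)"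
    using assms by (simp add: exp_diff)
  moreover have "p * (- ln v * (s - 1 / p) - \<kappa>) - ln v = - p * (\<kappa> + s * ln v)"
    using assms by (simp add: field_simps)
  moreover have "exp \<kappa> * v powr s = exp (\<kappa> + s * ln v)"
    using assms by (simp add: powr_def exp_add)
  ultimately show ?thesis by (simp add: powr_def)
qed

lemma bounded_integrable_unit_subinterval:
  fixes f :: "real \<Rightarrow> real"
  assumes "f \<in> borel_measurable (lebesgue_on {0..1})" "\<And>x. x \<in> {0..1} \<Longrightarrow> \<bar>f x\<bar> \<le> B"
    and "Q \<in> sets lebesgue" "Q \<subseteq> {0..1}"
  shows "integrable (lebesgue_on Q) f"
proof -
  have "Q \<in> lmeasurable"
    using assms(3,4) by (meson bounded_closed_interval bounded_set_imp_lmeasurable bounded_subset)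
  then interpret finite_measure "lebesgue_on Q" by (rule finite_measure_lebesgue_on)
  show ?thesis
    using assms(2,4) measurable_restrict_mono[OF assms(1,4)]
    by (intro integrable_const_bound[of _ B]) (auto intro!: AE_I2)
qed

section \<open>One-sided oscillation yields the norm estimate\<close>

text \<open>The form in which the BLO condition is used: at scale \<open>|Q|\<close> the function drops below its average by
  at most a multiple of \<open>1 / ln (1/|Q|)\<close>.\<close>

lemma BLO_inv_log_lower_bound:
  assumes "f \<in> BLO_inv_log"
  obtains K where "0 < K" "\<And>Q. unit_subinterval Q \<Longrightarrow>
    AE x in lebesgue_on Q. - ln (measure lebesgue Q) * (avg f Q - f x) \<le> K"
proof -
  obtain C where C: "0 < C"
    "\<And>r. 0 < r \<Longrightarrow> r \<le> 1 \<Longrightarrow> blo_eta f r \<le> ereal (C / ln (exp 1 + 1 / r))"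
    using assms by (auto simp: BLO_inv_log_def)
  have "AE x in lebesgue_on Q. - ln (measure lebesgue Q) * (avg f Q - f x) \<le> 2 * C"
    if Q: "unit_subinterval Q" for Q
  proof -
    define v where "v = measure lebesgue Q"
    define L where "L = ln (exp 1 + 1 / v)"
    have v: "0 < v" "v \<le> 1"
      using unit_subinterval_endpoints[OF Q] by (smt (verit) v_def)+
    have L: "1 \<le> L" "- ln v \<le> L"
    proof -
      have "ln (exp 1) \<le> L" unfolding L_def using v by (subst ln_le_cancel_iff) (auto intro: add_pos_pos)
      then show "1 \<le> L" by simp
      have "ln (1 / v) \<le> L" unfolding L_def using v by (subst ln_le_cancel_iff) (auto intro: add_pos_pos)
      then show "- ln v \<le> L" using v by (simp add: ln_div)
    qed
    \<comment> \<open>The essential infimum is a supremum of almost everywhere lower bounds; doubling \<open>C\<close> makes the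
      inequality strict, so that one of these bounds lies above the threshold.\<close>
    have "ereal (avg f Q) - essinf (lebesgue_on Q) f \<le> blo_eta f v"
      unfolding blo_eta_def using Q by (intro SUP_upper) (auto simp: v_def)
    also have "\<dots> \<le> ereal (C / L)" using C(2)[of v] v by (simp add: L_def)
    finally have "ereal (avg f Q) - essinf (lebesgue_on Q) f \<le> ereal (C / L)" .
    moreover have "C / L < 2 * C / L" using C L by (simp add: divide_simps)
    ultimately have "ereal (avg f Q - 2 * C / L) < essinf (lebesgue_on Q) f"
      by (cases "essinf (lebesgue_on Q) f") auto
    then obtain z where z: "AE x in lebesgue_on Q. z \<le> ereal (f x)" "ereal (avg f Q - 2 * C / L) < z"
      unfolding essinf_def by (auto simp: less_Sup_iff)
    show ?thesis using z(1)
    proof (rule AE_mp, intro AE_I2 impI)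
      fix x assume "z \<le> ereal (f x)"
      with z(2) have "ereal (avg f Q - 2 * C / L) < ereal (f x)" by (rule less_le_trans)
      then have "avg f Q - f x \<le> 2 * C / L" by simp
      then have "- ln v * (avg f Q - f x) \<le> - ln v * (2 * C / L)"
        using v by (intro mult_left_mono) auto
      also have "\<dots> \<le> L * (2 * C / L)" using L C by (intro mult_right_mono) auto
      also have "\<dots> = 2 * C" using L by simp
      finally show "- ln (measure lebesgue Q) * (avg f Q - f x) \<le> 2 * C" by (simp add: v_def)
    qed
  qed
  then show ?thesis using that[of "2 * C"] C(1) by simp
qed

text \<open>Put \<open>y = ln (1/|Q|) (s - 1/p)\<close>, so that \<open>y \<le> K\<close> almost everywhere and \<open>y\<close> has average \<open>0\<close> over \<open>Q\<close>.
  The upper bound for the norm is then immediate with constant \<open>exp K\<close>. For the lower bound,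
  \<open>exp (p (y + d)) \<ge> 1 + p y + d\<close>, where \<open>p y\<close> is replaced by the affine minorant \<open>P (y - K)\<close>, whose
  average is \<open>- P K\<close>. With \<open>d = P K + 1\<close> the modular exceeds \<open>1\<close>, so the norm is at least
  \<open>exp (- d)\<close> times the power.\<close>

theorem char_norm_estimate_if_BLO_inv_log:
  assumes meas: "p \<in> borel_measurable (lebesgue_on {0..1})"
    and bounds: "\<And>x. x \<in> {0..1} \<Longrightarrow> 1 \<le> p x \<and> p x \<le> P"
    and blo: "(\<lambda>x. 1 / p x) \<in> BLO_inv_log"
  shows "char_norm_estimate p"
proof -
  obtain K where K: "0 < K" "\<And>Q. unit_subinterval Q \<Longrightarrow>
      AE x in lebesgue_on Q. - ln (measure lebesgue Q) * (avg (\<lambda>x. 1 / p x) Q - 1 / p x) \<le> K"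
    using BLO_inv_log_lower_bound[OF blo] by blast
  define d where "d = P * K + 1"
  have "exp (- d) * measure lebesgue Q powr avg (\<lambda>x. 1 / p x) Q \<le> var_norm p (indicat_real Q) \<and>
      var_norm p (indicat_real Q) \<le> exp K * measure lebesgue Q powr avg (\<lambda>x. 1 / p x) Q"
    if Q: "unit_subinterval Q" for Q
  proof -
    define v where "v = measure lebesgue Q"
    define s where "s = avg (\<lambda>x. 1 / p x) Q"
    define S where "S = {l. 0 < l \<and> modular p (\<lambda>x. indicat_real Q x / l) \<le> 1}"
    have Q01: "Q \<subseteq> {0..1}" using Q by (simp add: unit_subinterval_def)
    have v: "0 < v" "v \<le> 1" and Qm: "Q \<in> sets lebesgue"
      using unit_subinterval_endpoints[OF Q] by (smt (verit) v_def)+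
    have Ql: "Q \<in> lmeasurable"
      using Qm Q01 by (meson bounded_closed_interval bounded_set_imp_lmeasurable bounded_subset)
    have eQ: "emeasure (lebesgue_on Q) (space (lebesgue_on Q)) = ennreal v"
      using Ql Qm by (simp add: v_def emeasure_restrict_space emeasure_eq_measure2 fmeasurableD2)
    have P: "1 \<le> p x" "p x \<le> P" if "x \<in> Q" for x using bounds Q01 that by auto
    have pm: "p \<in> borel_measurable (lebesgue_on Q)"
      using meas Q01 by (rule measurable_restrict_mono)
    have osc: "AE x in lebesgue_on Q. - ln v * (s - 1 / p x) \<le> K"
      using K(2)[OF Q] by (simp add: v_def s_def)
    have N: "var_norm p (indicat_real Q) = Inf S" by (simp add: var_norm_def S_def)
    have "modular p (\<lambda>x. indicat_real Q x / (exp K * v powr s))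
        = (\<integral>\<^sup>+ x. ennreal ((exp K * v powr s) powr (- p x)) \<partial>lebesgue_on Q)"
      using v by (intro modular_indicator Qm Q01) auto
    also have "\<dots> \<le> (\<integral>\<^sup>+ x. ennreal (1 / v) \<partial>lebesgue_on Q)"
    proof (rule nn_integral_mono_AE, use osc in \<open>rule AE_mp\<close>, intro AE_I2 impI)
      fix x assume x: "x \<in> space (lebesgue_on Q)" and le: "- ln v * (s - 1 / p x) \<le> K"
      have "p x * (- ln v * (s - 1 / p x) - K) \<le> 0"
        using le P[of x] x by (intro mult_nonneg_nonpos) auto
      then show "ennreal ((exp K * v powr s) powr (- p x)) \<le> ennreal (1 / v)"
        using v P[of x] x by (subst rescaled_powr_eq) (auto intro!: ennreal_leI divide_right_mono)
    qed
    also have "\<dots> = 1" using v eQ by (simp flip: ennreal_mult)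
    finally have inS: "exp K * v powr s \<in> S" using v by (simp add: S_def)
    have up: "Inf S \<le> exp K * v powr s"
      by (rule cInf_lower[OF inS]) (auto simp: S_def intro!: bdd_belowI[of _ 0])
    have low: "exp (- d) * v powr s \<le> Inf S"
    proof (rule cInf_greatest)
      show "S \<noteq> {}" using inS by blast
      fix l assume "l \<in> S"
      then have l: "0 < l" "modular p (\<lambda>x. indicat_real Q x / l) \<le> 1" by (auto simp: S_def)
      show "exp (- d) * v powr s \<le> l"
      proof (rule ccontr)
        assume "\<not> exp (- d) * v powr s \<le> l"
        then have less: "l < exp (- d) * v powr s" by simp
        define g where "g = (\<lambda>x. l powr (- p x))"
        \<comment> \<open>Minorant of the integrand \<open>g\<close>, affine in \<open>1/p\<close>, with integral \<open>2\<close>.\<close>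
        define h where "h = (\<lambda>x. (1 + d + P * (- ln v * (s - 1 / p x) - K)) / v)"
        have g1: "(\<integral>\<^sup>+ x. ennreal (g x) \<partial>lebesgue_on Q) \<le> 1"
          using l modular_indicator[OF Qm Q01, of l p] by (simp add: g_def)
        have gm: "g \<in> borel_measurable (lebesgue_on Q)" unfolding g_def using pm by measurable
        have gi: "integrable (lebesgue_on Q) g"
          using gm g1 by (intro integrableI_nonneg) (auto simp: g_def intro: le_less_trans)
        have gle: "integral\<^sup>L (lebesgue_on Q) g \<le> 1"
          using g1 gi by (subst (asm) nn_integral_eq_integral) (auto simp: g_def)
        have qi: "integrable (lebesgue_on Q) (\<lambda>x. 1 / p x)"
          using meas bounds by (intro bounded_integrable_unit_subinterval[OF _ _ Qm Q01, of _ 1]) force+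
        have ci: "integrable (lebesgue_on Q) (\<lambda>x. c)" for c :: real
          using Ql by (simp add: finite_measure.integrable_const finite_measure_lebesgue_on)
        have hi: "integrable (lebesgue_on Q) h"
          unfolding h_def using qi ci by auto
        have sq: "integral\<^sup>L (lebesgue_on Q) (\<lambda>x. 1 / p x) = s * v"
          using v by (simp add: s_def avg_def v_def)
        have "AE x in lebesgue_on Q. h x \<le> g x"
          using osc
        proof (rule AE_mp, intro AE_I2 impI)
          fix x assume x: "x \<in> space (lebesgue_on Q)" and le: "- ln v * (s - 1 / p x) \<le> K"
          define y where "y = - ln v * (s - 1 / p x)"
          have p: "1 \<le> p x" "p x \<le> P" using P[of x] x by auto
          have d: "0 \<le> d" using p K(1) by (simp add: d_def)
          have "P * (y - K) \<le> p x * y"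
          proof (cases "0 \<le> y")
            case True
            then have "P * (y - K) \<le> 0" using le p by (intro mult_nonneg_nonpos) (auto simp: y_def)
            with True p show ?thesis by (smt (verit) mult_nonneg_nonneg)
          next
            case False
            then have "P * y \<le> p x * y" using p by (intro mult_right_mono_neg) auto
            moreover have "0 \<le> P * K" using p K(1) by simp
            ultimately show ?thesis by (simp add: algebra_simps)
          qed
          moreover have "d \<le> p x * d" using p d by (simp add: mult_le_cancel_right1)
          ultimately have "1 + d + P * (y - K) \<le> 1 + p x * (y + d)" by (simp add: algebra_simps)
          also have "\<dots> \<le> exp (p x * (y + d))" by (rule exp_ge_add_one_self)
          finally have "h x \<le> exp (p x * (y + d)) / v"
            using v by (simp add: h_def y_def divide_right_mono)
          also have "\<dots> = (exp (- d) * v powr s) powr (- p x)"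
            using v p by (subst rescaled_powr_eq) (auto simp: y_def)
          also have "\<dots> \<le> g x"
            unfolding g_def using less l p by (intro powr_mono2') auto
          finally show "h x \<le> g x" .
        qed
        then have "integral\<^sup>L (lebesgue_on Q) h \<le> integral\<^sup>L (lebesgue_on Q) g"
          by (rule integral_mono_AE[OF hi gi])
        moreover have "integral\<^sup>L (lebesgue_on Q) h = 2"
        proof -
          have h: "h = (\<lambda>x. (1 + d + P * (- ln v * s - K)) / v + (P * ln v / v) * (1 / p x))"
            using v by (auto simp: h_def field_simps)
          have "integral\<^sup>L (lebesgue_on Q) h
              = integral\<^sup>L (lebesgue_on Q) (\<lambda>x. (1 + d + P * (- ln v * s - K)) / v)
                + (P * ln v / v) * integral\<^sup>L (lebesgue_on Q) (\<lambda>x. 1 / p x)"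
            unfolding h using qi ci
            by (subst Bochner_Integration.integral_add) (simp_all only: integral_mult_right_zero integrable_mult_right)
          also have "\<dots> = v * ((1 + d + P * (- ln v * s - K)) / v) + (P * ln v / v) * (s * v)"
            using Qm by (simp only: sq lebesgue_integral_const) (simp add: measure_restrict_space v_def)
          also have "\<dots> = 2" using v by (simp add: d_def field_simps)
          finally show ?thesis .
        qed
        ultimately show False using gle by simp
      qed
    qed
    show ?thesis using up low by (simp add: N v_def s_def)
  qed
  then show ?thesis
    unfolding char_norm_estimate_def uniformly_asymp_def
    by (intro exI[of _ "exp (- d)"] exI[of _ "exp K"]) auto
qed


section \<open>Radial profiles on the iterated logarithmic scale\<close>

definition iter_log :: "real \<Rightarrow> real" where
  "iter_log x = ln (1 - ln x)"

text \<open>The difference is about \<open>ln (b/x) / (1 - ln b)\<close>. Bounding the logarithm by a square root keeps an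
  integrable singularity at \<open>0\<close> and has an antiderivative continuous up to \<open>0\<close>.\<close>

lemma iter_log_diff_le:
  assumes "0 < x" "x \<le> b" "b \<le> 1"
  shows "iter_log b \<le> iter_log x"
    "iter_log x - iter_log b \<le> 2 * (sqrt b / sqrt x - 1) / (1 - ln b)"
proof -
  have lb: "ln b \<le> 0" "ln x \<le> ln b" using assms by auto
  then show "iter_log b \<le> iter_log x" unfolding iter_log_def by simp
  have nz: "ln b < 1" using lb by linarith
  have "iter_log x - iter_log b = ln ((1 - ln x) / (1 - ln b))"
    using lb by (simp add: iter_log_def ln_div)
  also have "\<dots> \<le> (1 - ln x) / (1 - ln b) - 1"
    using lb by (intro ln_le_minus_one) auto
  also have "\<dots> = (ln b - ln x) / (1 - ln b)"
    using nz diff_divide_distrib[of "1 - ln x" "1 - ln b" "1 - ln b"] by simp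
  also have "ln b - ln x = 2 * ln (sqrt b / sqrt x)"
    using assms by (simp add: ln_div ln_sqrt)
  also have "2 * ln (sqrt b / sqrt x) / (1 - ln b) \<le> 2 * (sqrt b / sqrt x - 1) / (1 - ln b)"
  proof (rule divide_right_mono)
    have "ln (sqrt b / sqrt x) \<le> sqrt b / sqrt x - 1"
      using assms by (intro ln_le_minus_one) auto
    then show "2 * ln (sqrt b / sqrt x) \<le> 2 * (sqrt b / sqrt x - 1)" by simp
  qed (use nz in simp)
  finally show "iter_log x - iter_log b \<le> 2 * (sqrt b / sqrt x - 1) / (1 - ln b)" .
qed

lemma has_integral_inverse_sqrt_profile:
  assumes "0 \<le> a" "a \<le> b"
  shows "((\<lambda>x. 2 * (sqrt b / sqrt x - 1)) has_integral 2 * (sqrt b - sqrt a)\<^sup>2) {a..b}"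
proof -
  define F where "F = (\<lambda>x::real. 4 * sqrt b * sqrt x - 2 * x)"
  have "((\<lambda>x. 2 * (sqrt b / sqrt x - 1)) has_integral (F b - F a)) {a..b}"
  proof (rule fundamental_theorem_of_calculus_interior[OF assms(2)])
    show "continuous_on {a..b} F" unfolding F_def by (intro continuous_intros)
    fix x assume "x \<in> {a<..<b}"
    then have "0 < x" using assms by simp
    then show "(F has_vector_derivative 2 * (sqrt b / sqrt x - 1)) (at x)"
      unfolding F_def has_real_derivative_iff_has_vector_derivative[symmetric]
      by (auto intro!: derivative_eq_intros simp: field_simps)
  qed
  moreover have "F b - F a = 2 * (sqrt b - sqrt a)\<^sup>2"
    using assms by (simp add: F_def power2_diff algebra_simps flip: power2_eq_square)
  ultimately show ?thesis by simp
qed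

lemma mult_one_minus_ln_mono:
  fixes x y :: real
  assumes "0 < x" "x \<le> y" "y \<le> 1"
  shows "x * (1 - ln x) \<le> y * (1 - ln y)"
proof -
  have "ln (y / x) \<le> y / x - 1" using assms by (intro ln_le_minus_one) auto
  then have "x * ln y - x * ln x \<le> y - x"
    using assms by (simp add: ln_div field_simps)
  moreover have "(y - x) * ln y \<le> 0" using assms by (intro mult_nonneg_nonpos) auto
  ultimately show ?thesis by (simp add: algebra_simps)
qed

text \<open>The radial function \<open>x \<mapsto> \<phi> (ln (1 + ln (1/x)))\<close> is nonincreasing on \<open>(0,1]\<close>; every property of the
  exponent needed later, except for the long steep stretches, follows from the four conditions on
  the profile \<open>\<phi>\<close>.\<close>

locale lipschitz_profile =
  fixes \<phi> :: "real \<Rightarrow> real" and C B :: real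
  assumes mono: "u \<le> w \<Longrightarrow> \<phi> u \<le> \<phi> w"
    and lip: "u \<le> w \<Longrightarrow> \<phi> w - \<phi> u \<le> C * (w - u)"
    and bounds: "0 \<le> \<phi> u" "\<phi> u \<le> B"
    and C_pos: "0 < C"
begin

definition radial :: "real \<Rightarrow> real" where
  "radial x = \<phi> (iter_log x)"

lemma radial_bounds: "0 \<le> radial x" "radial x \<le> B"
  using bounds by (auto simp: radial_def)

lemma radial_antimono:
  assumes "0 < x" "x \<le> y" "y \<le> 1"
  shows "radial y \<le> radial x"
  using assms by (auto simp: radial_def intro!: mono iter_log_diff_le)

lemma radial_measurable: "radial \<in> borel_measurable lebesgue"
proof -
  have "mono \<phi>" by (auto intro: monoI mono)
  then have "\<phi> \<in> borel_measurable borel" by (rule borel_measurable_mono)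
  then have "radial \<in> borel_measurable borel"
    unfolding radial_def iter_log_def by measurable
  then show ?thesis by (simp add: measurable_completion)
qed

lemma radial_measurable_on: "radial \<in> borel_measurable (lebesgue_on S)"
  using radial_measurable by (rule measurable_restrict_space1)

lemma radial_integrable_on:
  assumes "Q \<in> sets lebesgue" "Q \<subseteq> {0..1}"
  shows "integrable (lebesgue_on Q) radial"
  using assms radial_bounds radial_measurable_on
  by (intro bounded_integrable_unit_subinterval[of _ B]) auto

text \<open>On \<open>[a, b]\<close> of length \<open>l\<close> the averaged oscillation is at most \<open>2 C (l/b) / (1 - ln b)\<close>: the further
  the interval lies from \<open>0\<close> the smaller the factor \<open>l/b\<close>, which compensates that
  \<open>1 - ln b\<close> is smaller than \<open>1 - ln l\<close>, because \<open>x (1 - ln x)\<close> increases on \<open>(0,1]\<close>.\<close>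

lemma avg_le_right_end:
  assumes "0 \<le> a" "a < b" "b \<le> 1" "{a<..<b} \<subseteq> Q" "Q \<subseteq> {a..b}"
    "Q \<in> sets lebesgue" "measure lebesgue Q = b - a"
  shows "avg radial Q \<le> radial b + 2 * C / (1 - ln (b - a))"
proof -
  define l where "l = b - a"
  define h where "h = (\<lambda>x. radial b + C / (1 - ln b) * (2 * (sqrt b / sqrt x - 1)))"
  have lb: "ln b \<le> 0" using assms by simp
  have l: "0 < l" "l \<le> b" using assms by (auto simp: l_def)
  have Qi: "integrable (lebesgue_on Q) radial" using assms by (intro radial_integrable_on) auto
  have "integral\<^sup>L (lebesgue_on Q) radial = integral Q radial"
    by (rule lebesgue_integral_eq_integral[OF Qi assms(6)])
  also have "integral Q radial = integral {a<..<b} radial"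
  proof (rule integral_spike_set)
    show "negligible {x \<in> Q - {a<..<b}. radial x \<noteq> 0}"
      by (rule negligible_subset[of "{a, b}"]) (use assms(5) in force)+
    have "{x \<in> {a<..<b} - Q. radial x \<noteq> 0} = {}" using assms(4) by auto
    then show "negligible {x \<in> {a<..<b} - Q. radial x \<noteq> 0}" by (simp only: negligible_empty)
  qed
  also have "\<dots> \<le> l * radial b + C / (1 - ln b) * (2 * (sqrt b - sqrt a)\<^sup>2)"
  proof (rule has_integral_le)
    have "integrable (lebesgue_on {a<..<b}) radial" using assms by (intro radial_integrable_on) auto
    then have "radial integrable_on {a<..<b}" by (intro integrable_on_lebesgue_on) auto
    then show "(radial has_integral integral {a<..<b} radial) {a<..<b}" by (rule integrable_integral)
    have "(h has_integral ((b - a) * radial b + C / (1 - ln b) * (2 * (sqrt b - sqrt a)\<^sup>2))) {a..b}"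
      unfolding h_def using assms
      by (intro has_integral_add has_integral_mult_right has_integral_inverse_sqrt_profile)
        (use has_integral_const_real[of "radial b" a b] in auto)
    then show "(h has_integral (l * radial b + C / (1 - ln b) * (2 * (sqrt b - sqrt a)\<^sup>2))) {a<..<b}"
      by (simp add: has_integral_Icc_iff_Ioo l_def)
    fix x assume "x \<in> {a<..<b}"
    then have x: "0 < x" "x \<le> b" using assms by auto
    have "radial x - radial b \<le> C * (iter_log x - iter_log b)"
      unfolding radial_def by (rule lip) (rule iter_log_diff_le[OF x assms(3)])
    also have "\<dots> \<le> C * (2 * (sqrt b / sqrt x - 1) / (1 - ln b))"
      using C_pos by (intro mult_left_mono iter_log_diff_le(2)[OF x assms(3)]) auto
    also have "\<dots> = C / (1 - ln b) * (2 * (sqrt b / sqrt x - 1))" by simp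
    finally show "radial x \<le> h x" unfolding h_def by linarith
  qed
  also have "\<dots> \<le> l * radial b + C / (1 - ln b) * (2 * (l * (l / b)))"
  proof -
    have "l = (sqrt b - sqrt a) * (sqrt b + sqrt a)"
      using assms by (simp add: l_def algebra_simps)
    then have "l\<^sup>2 = (sqrt b - sqrt a)\<^sup>2 * (sqrt b + sqrt a)\<^sup>2" by (simp add: power_mult_distrib)
    moreover have "b \<le> (sqrt b + sqrt a)\<^sup>2" using assms by (simp add: power2_sum)
    ultimately have "(sqrt b - sqrt a)\<^sup>2 * b \<le> l\<^sup>2" by (simp add: mult_left_mono)
    then have "(sqrt b - sqrt a)\<^sup>2 \<le> l * (l / b)"
      using l by (simp add: field_simps power2_eq_square)
    then show ?thesis using C_pos lb by (intro add_left_mono mult_left_mono) auto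
  qed
  also have "\<dots> \<le> l * (radial b + 2 * C / (1 - ln l))"
  proof -
    have "l * (1 - ln l) \<le> b * (1 - ln b)" using l assms by (intro mult_one_minus_ln_mono) auto
    moreover have "0 < 1 - ln l" using l assms by (smt (verit) ln_le_zero_iff)
    moreover have "0 < b * (1 - ln b)" using l lb by (intro mult_pos_pos) linarith+
    ultimately have "l / (b * (1 - ln b)) \<le> 1 / (1 - ln l)"
      by (simp add: pos_divide_le_eq pos_le_divide_eq)
    then have "(l / b) / (1 - ln b) \<le> 1 / (1 - ln l)" by simp
    then have "2 * l * C * ((l / b) / (1 - ln b)) \<le> 2 * l * C * (1 / (1 - ln l))"
      using l C_pos by (intro mult_left_mono) auto
    then show ?thesis by (simp add: algebra_simps)
  qed
  finally have "integral\<^sup>L (lebesgue_on Q) radial \<le> l * (radial b + 2 * C / (1 - ln l))" .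
  then have "integral\<^sup>L (lebesgue_on Q) radial / l \<le> radial b + 2 * C / (1 - ln l)"
    using l by (simp add: pos_divide_le_eq mult.commute)
  then show ?thesis by (simp add: avg_def assms(7) l_def)
qed

lemma avg_affine:
  assumes "unit_subinterval Q"
  shows "avg (\<lambda>x. c + d * radial x) Q = c + d * avg radial Q"
proof -
  have Q: "0 < measure lebesgue Q" "Q \<subseteq> {0..1}" "Q \<in> sets lebesgue"
    using assms unit_subinterval_endpoints[OF assms] by (auto simp: unit_subinterval_def)
  then have "Q \<in> lmeasurable"
    by (meson bounded_closed_interval bounded_set_imp_lmeasurable bounded_subset)
  then interpret finite_measure "lebesgue_on Q" by (rule finite_measure_lebesgue_on)
  have "(LINT x|lebesgue_on Q. c + d * radial x) = measure lebesgue Q * c + d * (LINT x|lebesgue_on Q. radial x)"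
    using radial_integrable_on[OF Q(3,2)] Q by (simp add: measure_restrict_space)
  then show ?thesis using Q(1) by (simp add: avg_def field_simps)
qed

text \<open>A decreasing function has its essential infimum over an interval at the right end, so the bound on
  averages is all that is needed.\<close>

lemma shifted_profile_in_BLO_inv_log: "(\<lambda>x. c + radial x) \<in> BLO_inv_log"
proof -
  have "blo_eta (\<lambda>x. c + radial x) r \<le> ereal (4 * C / ln (exp 1 + 1 / r))" if r: "0 < r" "r \<le> 1" for r
    unfolding blo_eta_def
  proof (rule SUP_least, clarify)
    fix Q assume Q: "unit_subinterval Q" and le: "measure lebesgue Q \<le> r"
    obtain a b where ab: "0 \<le> a" "a < b" "b \<le> 1" "{a<..<b} \<subseteq> Q" "Q \<subseteq> {a..b}"
        "Q \<in> sets lebesgue" "measure lebesgue Q = b - a"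
      using unit_subinterval_endpoints[OF Q] by blast
    have "negligible {0::real}" by simp
    then have "AE x in lebesgue. x \<noteq> 0"
      by (intro AE_I'[of "{0}"]) (auto simp: negligible_iff_null_sets)
    then have "AE x in lebesgue. x \<in> Q \<longrightarrow> c + radial b \<le> c + radial x"
      by (rule AE_mp) (use ab in \<open>auto intro!: AE_I2 radial_antimono\<close>)
    then have "AE x in lebesgue_on Q. c + radial b \<le> c + radial x"
      using ab by (simp add: AE_restrict_space_iff)
    then have ess: "ereal (c + radial b) \<le> essinf (lebesgue_on Q) (\<lambda>x. c + radial x)" by (rule essinf_ge)
    have "avg (\<lambda>x. c + radial x) Q = c + avg radial Q" using avg_affine[OF Q, of c 1] by simp
    then have "avg (\<lambda>x. c + radial x) Q \<le> c + radial b + 2 * C / (1 - ln (b - a))"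
      using avg_le_right_end[OF ab] by simp
    with ess have "ereal (avg (\<lambda>x. c + radial x) Q) - essinf (lebesgue_on Q) (\<lambda>x. c + radial x)
        \<le> ereal (2 * C / (1 - ln (b - a)))"
      by (cases "essinf (lebesgue_on Q) (\<lambda>x. c + radial x)") auto
    also have "\<dots> \<le> ereal (4 * C / ln (exp 1 + 1 / r))"
    proof -
      have lr: "ln r \<le> 0" using r by simp
      have "exp 1 + 1 / r \<le> exp 2 / r"
      proof -
        have e: "2 \<le> exp (1::real)" using exp_ge_add_one_self[of "1::real"] by simp
        then have "2 * exp 1 \<le> exp 1 * exp (1::real)" by (rule mult_right_mono) simp
        moreover have "exp 1 * r \<le> exp 1" using r by simp
        ultimately have "exp 1 * r + 1 \<le> exp 1 * exp 1" using e by linarith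
        also have "exp 1 * exp 1 = exp (2::real)" by (simp flip: exp_add)
        finally have "(exp 1 * r + 1) / r \<le> exp 2 / r" using r by (intro divide_right_mono) auto
        then show ?thesis using r by (simp add: add_divide_distrib)
      qed
      then have "ln (exp 1 + 1 / r) \<le> ln (exp 2 / r)"
        using r by (subst ln_le_cancel_iff) (auto intro!: add_pos_pos)
      also have "\<dots> \<le> 2 * (1 - ln r)" using r lr by (simp add: ln_div)
      also have "\<dots> \<le> 2 * (1 - ln (b - a))" using ab le r by simp
      finally have "ln (exp 1 + 1 / r) \<le> 2 * (1 - ln (b - a))" .
      moreover have "0 < ln (exp 1 + 1 / r)"
        using r exp_ge_add_one_self[of 1] by (intro ln_gt_zero) (smt (verit) zero_less_divide_1_iff)
      ultimately have "4 * C / (2 * (1 - ln (b - a))) \<le> 4 * C / ln (exp 1 + 1 / r)"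
        using C_pos by (intro divide_left_mono) (auto intro!: mult_pos_pos)
      moreover have "4 * C / (2 * (1 - ln (b - a))) = 2 * C / (1 - ln (b - a))"
        using mult_divide_mult_cancel_left[of 2 "2 * C" "1 - ln (b - a)"] by (simp add: mult.assoc)
      ultimately show ?thesis by simp
    qed
    finally show "ereal (avg (\<lambda>x. c + radial x) Q) - essinf (lebesgue_on Q) (\<lambda>x. c + radial x)
        \<le> ereal (4 * C / ln (exp 1 + 1 / r))" .
  qed
  moreover have "integrable (lebesgue_on {0..1}) (\<lambda>x. c + radial x)"
    using radial_integrable_on[of "{0..1}"] finite_measure.integrable_const[OF finite_measure_lebesgue_on]
    by simp
  ultimately show ?thesis
    unfolding BLO_inv_log_def using C_pos by (auto intro!: exI[of _ "4 * C"])
qed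


text \<open>The hypothesis \<open>steep\<close> says that the radial function rises by at least \<open>2 M/\<Lambda>\<close> between \<open>exp (- \<Lambda>)\<close>
  and \<open>exp (- \<Lambda> - M)\<close>. On \<open>Q = [0, exp (- \<Lambda>)]\<close> this beats the fraction \<open>exp (- M)\<close> of \<open>Q\<close> on which
  it takes effect: the modular of \<open>\<chi>\<^sub>Q\<close>, normalized by a constant \<open>exp \<kappa>\<close> times the expected norm,
  is at least \<open>exp (M - 2 C - \<kappa>)\<close>, which exceeds \<open>1\<close> for large \<open>M\<close>. The exponent is the conjugate of
  \<open>1 / (1/4 + radial)\<close>.\<close>

lemma steep_profile_not_char_norm_estimate:
  assumes "B < 3 / 4"
    and steep: "\<And>N. \<exists>\<Lambda> > 0. \<exists>M \<ge> N. 2 * M \<le> \<Lambda> * (\<phi> (ln (1 + \<Lambda> + M)) - \<phi> (ln (1 + \<Lambda>)))"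
  shows "\<not> char_norm_estimate (\<lambda>x. 1 / (3 / 4 - radial x))"
proof
  define p where "p = (\<lambda>x. 1 / (3 / 4 - radial x))"
  have p: "1 \<le> p x" for x
    using radial_bounds[of x] assms(1) by (simp add: p_def divide_simps)
  assume "char_norm_estimate (\<lambda>x. 1 / (3 / 4 - radial x))"
  then obtain D where D: "0 < D" "\<And>Q. unit_subinterval Q \<Longrightarrow>
      var_norm p (indicat_real Q) \<le> D * measure lebesgue Q powr avg (\<lambda>x. 1 / p x) Q"
    unfolding char_norm_estimate_def uniformly_asymp_def p_def by blast
  \<comment> \<open>A constant strictly above \<open>D\<close>, so that some admissible \<open>l\<close> lies below the bound although the
    infimum in the norm need not be attained.\<close>
  define \<kappa> where "\<kappa> = ln (D + 1)"
  have \<kappa>: "exp \<kappa> = D + 1" "0 \<le> \<kappa>" using D(1) by (auto simp: \<kappa>_def)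
  obtain \<Lambda> M where M: "0 < \<Lambda>" "2 * C + \<kappa> + 1 \<le> M"
      "2 * M \<le> \<Lambda> * (\<phi> (ln (1 + \<Lambda> + M)) - \<phi> (ln (1 + \<Lambda>)))"
    using steep[of "2 * C + \<kappa> + 1"] by blast
  define R where "R = exp (- \<Lambda>)"
  define Q where "Q = {0..R}"
  define A where "A = {0<..R * exp (- M)}"
  define s where "s = avg (\<lambda>x. 1 / p x) Q"
  have M0: "0 < M" using M(2) C_pos \<kappa> by linarith
  have R: "0 < R" "R < 1" "ln R = - \<Lambda>" using M(1) by (auto simp: R_def)
  have Q: "unit_subinterval Q" using R by (auto simp: unit_subinterval_def Q_def)
  have mQ: "measure lebesgue Q = R" using R by (simp add: Q_def)
  have RM: "R * exp (- M) \<le> R" using R M0 by simp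
  have AQ: "A \<subseteq> Q" using order_trans[OF _ RM] by (auto simp: A_def Q_def)
  have s: "s = 3 / 4 - avg radial Q"
    using avg_affine[OF Q, of "3/4" "-1"] by (simp add: s_def p_def)
  have avg: "\<Lambda> * (avg radial Q - radial R) \<le> 2 * C"
  proof -
    have "avg radial Q \<le> radial R + 2 * C / (1 - ln (R - 0))"
      using R by (intro avg_le_right_end) (auto simp: Q_def)
    then have "\<Lambda> * (avg radial Q - radial R) \<le> \<Lambda> * (2 * C / (1 + \<Lambda>))"
      using M(1) R by (intro mult_left_mono) auto
    also have "\<dots> \<le> 2 * C" using M(1) C_pos by (simp add: field_simps)
    finally show ?thesis .
  qed
  define S where "S = {l. 0 < l \<and> modular p (\<lambda>x. indicat_real Q x / l) \<le> 1}"
  have mod: "modular p (\<lambda>x. indicat_real Q x / l) = (\<integral>\<^sup>+ x. ennreal (l powr (- p x)) \<partial>lebesgue_on Q)"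
    if "0 < l" for l
    using that R by (intro modular_indicator) (auto simp: Q_def)
  have "1 \<in> S"
    unfolding S_def using mod[of 1] R by (simp add: emeasure_restrict_space Q_def)
  moreover have "Inf S < exp \<kappa> * R powr s"
  proof -
    have "Inf S \<le> D * R powr s" using D(2)[OF Q] by (simp add: S_def var_norm_def mQ s_def)
    also have "\<dots> < exp \<kappa> * R powr s" using R by (simp add: \<kappa>)
    finally show ?thesis .
  qed
  ultimately obtain l where l: "0 < l" "modular p (\<lambda>x. indicat_real Q x / l) \<le> 1"
      "l < exp \<kappa> * R powr s"
    using cInf_lessD[of S] unfolding S_def by blast
  have pointwise: "exp (2 * M - 2 * C - \<kappa>) / R \<le> l powr (- p x)" if x: "x \<in> A" for x
  proof -
    have x0: "0 < x" "x \<le> R * exp (- M)" using x by (auto simp: A_def)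
    have "radial (R * exp (- M)) = \<phi> (ln (1 + \<Lambda> + M))" "radial R = \<phi> (ln (1 + \<Lambda>))"
      using R by (simp_all add: radial_def iter_log_def ln_mult algebra_simps)
    moreover have "radial (R * exp (- M)) \<le> radial x" using x0 RM R by (intro radial_antimono) linarith+
    ultimately have "\<Lambda> * (\<phi> (ln (1 + \<Lambda> + M)) - \<phi> (ln (1 + \<Lambda>))) \<le> \<Lambda> * (radial x - radial R)"
      using M(1) by (intro mult_left_mono) auto
    then have "2 * M \<le> \<Lambda> * (radial x - radial R)" using M(3) by linarith
    then have "2 * M - 2 * C \<le> \<Lambda> * (s - 1 / p x)"
      using avg by (simp add: s p_def algebra_simps)
    then have ge: "2 * M - 2 * C - \<kappa> \<le> - ln R * (s - 1 / p x) - \<kappa>" by (simp add: R)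
    have "2 * M - 2 * C - \<kappa> \<le> 1 * (- ln R * (s - 1 / p x) - \<kappa>)" using ge by simp
    also have "\<dots> \<le> p x * (- ln R * (s - 1 / p x) - \<kappa>)"
      using ge M(2) M0 p[of x] by (intro mult_right_mono) linarith+
    finally have "exp (2 * M - 2 * C - \<kappa>) / R \<le> exp (p x * (- ln R * (s - 1 / p x) - \<kappa>)) / R"
      using R by (simp add: divide_right_mono)
    also have "\<dots> = (exp \<kappa> * R powr s) powr (- p x)"
      using R p[of x] by (subst rescaled_powr_eq) auto
    also have "\<dots> \<le> l powr (- p x)" using l p[of x] by (intro powr_mono2') auto
    finally show ?thesis .
  qed
  have "ennreal (exp (M - 2 * C - \<kappa>)) = ennreal (exp (2 * M - 2 * C - \<kappa>) / R) * ennreal (R * exp (- M))"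
    using R by (simp add: algebra_simps flip: ennreal_mult exp_add)
  also have "ennreal (R * exp (- M)) = emeasure (lebesgue_on Q) A"
    using R AQ by (subst emeasure_restrict_space) (auto simp: A_def Q_def)
  also have "ennreal (exp (2 * M - 2 * C - \<kappa>) / R) * emeasure (lebesgue_on Q) A
      = (\<integral>\<^sup>+ x. ennreal (exp (2 * M - 2 * C - \<kappa>) / R) * indicator A x \<partial>lebesgue_on Q)"
    using AQ by (subst nn_integral_cmult_indicator) (auto simp: A_def Q_def sets_restrict_space_iff)
  also have "\<dots> \<le> (\<integral>\<^sup>+ x. ennreal (l powr (- p x)) \<partial>lebesgue_on Q)"
    by (intro nn_integral_mono) (auto simp: indicator_def intro!: ennreal_leI pointwise)
  also have "\<dots> \<le> 1" using l mod by simp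
  finally have "M - 2 * C - \<kappa> \<le> 0" by simp
  then show False using M(2) by simp
qed

end

section \<open>A bounded profile with increasingly long steep stretches\<close>

definition stair_level :: "nat \<Rightarrow> real" where
  "stair_level k = (1 - (1 / 2) ^ k) / 4"

text \<open>A ramp of slope \<open>8\<close> starting at \<open>2k\<close> and capped at \<open>stair_level k\<close>. Only its part between the
  levels \<open>k - 1\<close> and \<open>k\<close> is visible in the supremum below; using a supremum instead of a sum
  preserves the Lipschitz constant whatever the overlaps.\<close>

definition stair_step :: "nat \<Rightarrow> real \<Rightarrow> real" where
  "stair_step k u = min (stair_level k) (max 0 (8 * (u - 2 * real k)))"

definition stair :: "real \<Rightarrow> real" where
  "stair u = (SUP k. stair_step k u)"

lemma stair_level_bounds: "0 \<le> stair_level k" "stair_level k \<le> 1 / 4"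
  by (auto simp: stair_level_def power_le_one)

lemma stair_level_mono: "j \<le> k \<Longrightarrow> stair_level j \<le> stair_level k"
  by (simp add: stair_level_def power_decreasing)

lemma stair_step_bounds: "0 \<le> stair_step k u" "stair_step k u \<le> 1 / 4"
  unfolding stair_step_def using stair_level_bounds[of k] by linarith+

lemma stair_step_le_stair: "stair_step k u \<le> stair u"
  unfolding stair_def using stair_step_bounds
  by (intro cSUP_upper) (auto intro!: bdd_aboveI[of _ "1 / 4"])

lemma stair_leI: "(\<And>k. stair_step k u \<le> c) \<Longrightarrow> stair u \<le> c"
  unfolding stair_def by (intro cSUP_least) auto

interpretation stair: lipschitz_profile stair 8 "1 / 4"
proof
  fix u w :: real
  show "0 \<le> stair u" using stair_step_bounds(1) stair_step_le_stair by (rule order_trans)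
  show "stair u \<le> 1 / 4" using stair_step_bounds(2) by (rule stair_leI)
  assume le: "u \<le> w"
  show "stair u \<le> stair w"
  proof (rule stair_leI)
    fix k
    have "stair_step k u \<le> stair_step k w" using le by (auto simp: stair_step_def)
    also have "\<dots> \<le> stair w" by (rule stair_step_le_stair)
    finally show "stair_step k u \<le> stair w" .
  qed
  have "stair w \<le> stair u + 8 * (w - u)"
  proof (rule stair_leI)
    fix k
    have "stair_step k w \<le> stair_step k u + 8 * (w - u)"
      using le by (auto simp: stair_step_def min_def max_def)
    also have "\<dots> \<le> stair u + 8 * (w - u)" using stair_step_le_stair by simp
    finally show "stair_step k w \<le> stair u + 8 * (w - u)" .
  qed
  then show "stair w - stair u \<le> 8 * (w - u)" by simp
qed simp

lemma stair_le_level: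
  assumes "u \<le> 2 * real (k + 1) + stair_level k / 8"
  shows "stair u \<le> stair_level k"
proof (rule stair_leI)
  fix j
  consider "j \<le> k" | "j = k + 1" | "k + 2 \<le> j" by linarith
  then show "stair_step j u \<le> stair_level k"
  proof cases
    case 1
    then show ?thesis using stair_level_mono[of j k] by (auto simp: stair_step_def)
  next
    case 2
    then show ?thesis using assms stair_level_bounds[of k] by (auto simp: stair_step_def)
  next
    case 3
    then have "real k + 2 \<le> real j" by simp
    then have "8 * (u - 2 * real j) \<le> 0" using assms stair_level_bounds(2)[of k] by simp
    then show ?thesis using stair_level_bounds[of k] by (auto simp: stair_step_def)
  qed
qed

lemma level_le_stair:
  assumes "2 * real k + stair_level k / 8 \<le> u"
  shows "stair_level k \<le> stair u"
proof -
  have "stair_level k \<le> stair_step k u"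
    using assms by (auto simp: stair_step_def)
  then show ?thesis using stair_step_le_stair[of k u] by linarith
qed

text \<open>Take the rise from level \<open>k\<close> to level \<open>k + 1\<close>, which happens for \<open>ln (1 + t)\<close> between \<open>u\<close> and
  \<open>u + \<delta>\<close>. In the variable \<open>t\<close> its length \<open>M\<close> lies between \<open>\<delta> exp u\<close> and \<open>2 \<delta> exp u\<close>; its height is
  \<open>8 \<delta>\<close>, and slope \<open>8\<close> is what leaves the factor \<open>2\<close> after the losses \<open>M \<le> 2 \<delta> exp u\<close> and
  \<open>\<Lambda> \<ge> exp u / 2\<close>. Since \<open>exp u \<ge> 4\<^sup>k\<close> and \<open>\<delta>\<close> is of order \<open>2\<^sup>-\<^sup>k\<close>, \<open>M\<close> is unbounded.\<close>

lemma stair_steep: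
  "\<exists>\<Lambda> > 0. \<exists>M \<ge> N. 2 * M \<le> \<Lambda> * (stair (ln (1 + \<Lambda> + M)) - stair (ln (1 + \<Lambda>)))"
proof -
  obtain k where k: "64 * N < 2 ^ k" using real_arch_pow[of 2 "64 * N"] by auto
  define u where "u = 2 * real (k + 1) + stair_level k / 8"
  define \<delta> where "\<delta> = (1 / 2) ^ k / (64::real)"
  define \<Lambda> where "\<Lambda> = exp u - 1"
  define M where "M = exp (u + \<delta>) - exp u"
  have \<delta>: "0 < \<delta>" "\<delta> \<le> 1"
    using power_le_one[of "1/2::real" k] by (auto simp: \<delta>_def)
  have level: "stair_level (k + 1) = stair_level k + 8 * \<delta>"
    by (simp add: stair_level_def \<delta>_def field_simps)
  have u: "2 * real (k + 1) \<le> u" using stair_level_bounds[of k] by (simp add: u_def)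
  have eu: "4 ^ (k + 1) \<le> exp u"
  proof -
    have "(2::real) \<le> exp 1" using exp_ge_add_one_self[of "1::real"] by simp
    then have "2 ^ (2 * (k + 1)) \<le> exp (1::real) ^ (2 * (k + 1))" by (intro power_mono) auto
    also have "\<dots> = exp (2 * real (k + 1))" using exp_of_nat_mult[of "2 * (k + 1)" "1::real"] by simp
    also have "\<dots> \<le> exp u" using u by simp
    finally show ?thesis by (simp add: power_mult)
  qed
  have "(1::real) \<le> 4 ^ k" by simp
  then have eu2: "2 \<le> exp u" using eu unfolding power_add power_one_right by linarith
  have "1 + \<delta> \<le> exp \<delta>" by (rule exp_ge_add_one_self)
  then have "exp u * \<delta> \<le> exp u * (exp \<delta> - 1)" by (intro mult_left_mono, linarith, simp)
  then have Mlow: "exp u * \<delta> \<le> M" by (simp add: M_def exp_add algebra_simps)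
  have "exp \<delta> \<le> 1 + \<delta> + \<delta>\<^sup>2" using \<delta> by (intro exp_bound) auto
  moreover have "\<delta>\<^sup>2 \<le> \<delta>" using \<delta> by (simp add: power2_eq_square mult_le_cancel_right1)
  ultimately have "exp u * (exp \<delta> - 1) \<le> exp u * (2 * \<delta>)" by (intro mult_left_mono) auto
  then have Mup: "M \<le> 2 * (exp u * \<delta>)" by (simp add: M_def exp_add algebra_simps)
  have "N \<le> 2 ^ k / 64" using k by simp
  also have "2 ^ k / 64 = 4 ^ k * \<delta>"
  proof -
    have "(4::real) ^ k * (1 / 2) ^ k = 2 ^ k" by (simp flip: power_mult_distrib)
    then show ?thesis by (simp add: \<delta>_def)
  qed
  also have "\<dots> \<le> exp u * \<delta>"
  proof (rule mult_right_mono)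
    have "(0::real) \<le> 4 ^ k" by simp
    then show "4 ^ k \<le> exp u" using eu unfolding power_add power_one_right by linarith
  qed (use \<delta> in simp)
  also have "\<dots> \<le> M" by (rule Mlow)
  finally have N: "N \<le> M" .
  have \<Lambda>: "0 < \<Lambda>" using eu2 unfolding \<Lambda>_def by linarith
  have "stair (ln (1 + \<Lambda>)) \<le> stair_level k"
    by (rule stair_le_level) (simp add: \<Lambda>_def u_def)
  moreover have "stair_level (k + 1) \<le> stair (ln (1 + \<Lambda> + M))"
    by (rule level_le_stair) (use level in \<open>simp add: \<Lambda>_def M_def u_def\<close>)
  ultimately have "8 * \<delta> \<le> stair (ln (1 + \<Lambda> + M)) - stair (ln (1 + \<Lambda>))"
    using level by linarith
  then have "\<Lambda> * (8 * \<delta>) \<le> \<Lambda> * (stair (ln (1 + \<Lambda> + M)) - stair (ln (1 + \<Lambda>)))"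
    using \<Lambda> by (intro mult_left_mono) simp_all
  moreover have "4 * (exp u * \<delta>) \<le> \<Lambda> * (8 * \<delta>)"
  proof -
    have "(4 * exp u) * \<delta> \<le> (8 * \<Lambda>) * \<delta>" using eu2 \<delta> by (intro mult_right_mono) (auto simp: \<Lambda>_def)
    then show ?thesis by (simp add: algebra_simps)
  qed
  ultimately have "2 * M \<le> \<Lambda> * (stair (ln (1 + \<Lambda> + M)) - stair (ln (1 + \<Lambda>)))"
    using Mup by linarith
  then show ?thesis using N \<Lambda> by blast
qed

theorem theorem1p3:
  shows "\<exists>p :: real \<Rightarrow> real.
    p \<in> borel_measurable (lebesgue_on {0..1}) \<and>
    (\<forall>x\<in>{0..1}. 1 \<le> p x) \<and>
    1 < essinf (lebesgue_on {0..1}) p \<and>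
    essinf (lebesgue_on {0..1}) p \<le> esssup (lebesgue_on {0..1}) (\<lambda>x. ereal (p x)) \<and>
    esssup (lebesgue_on {0..1}) (\<lambda>x. ereal (p x)) < \<infinity> \<and>
    (\<lambda>x. 1 / p x) \<in> BLO_inv_log \<and>
    ((char_norm_estimate p \<and> \<not> char_norm_estimate (conj_exp p)) \<or>
     (\<not> char_norm_estimate p \<and> char_norm_estimate (conj_exp p)))"
proof -
  define f where "f = stair.radial"
  define p where "p = (\<lambda>x. 1 / (1 / 4 + f x))"
  have f: "0 \<le> f x" "f x \<le> 1 / 4" for x unfolding f_def by (rule stair.radial_bounds)+
  have p: "2 \<le> p x" "p x \<le> 4" for x
    using f[of x] by (simp_all add: p_def divide_simps)
  have inv: "(\<lambda>x. 1 / p x) = (\<lambda>x. 1 / 4 + f x)" by (simp add: p_def)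
  have conj: "conj_exp p = (\<lambda>x. 1 / (3 / 4 - f x))"
  proof
    fix x
    show "conj_exp p x = 1 / (3 / 4 - f x)"
      using f[of x] by (simp add: conj_exp_def p_def divide_simps)
  qed
  have meas: "p \<in> borel_measurable (lebesgue_on {0..1})"
    unfolding p_def f_def using stair.radial_measurable_on[of "{0..1}"] by measurable
  have blo: "(\<lambda>x. 1 / p x) \<in> BLO_inv_log"
    unfolding inv f_def by (rule stair.shifted_profile_in_BLO_inv_log)
  have inf: "1 < essinf (lebesgue_on {0..1}) p"
  proof -
    have "ereal 2 \<le> essinf (lebesgue_on {0..1}) p" using p by (intro essinf_ge) auto
    then show ?thesis by (rule less_le_trans[rotated]) simp
  qed
  have sup: "esssup (lebesgue_on {0..1}) (\<lambda>x. ereal (p x)) \<le> ereal 4"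
    using meas p by (intro esssup_I) auto
  have le: "essinf (lebesgue_on {0..1}) p \<le> esssup (lebesgue_on {0..1}) (\<lambda>x. ereal (p x))"
    unfolding essinf_def
  proof (rule Sup_least)
    fix z assume "z \<in> {z. AE x in lebesgue_on {0..1}. z \<le> ereal (p x)}"
    then have "AE x in lebesgue_on {0..1}. z \<le> ereal (p x)" by simp
    then have "esssup (lebesgue_on {0..1}) (\<lambda>x::real. z) \<le> esssup (lebesgue_on {0..1}) (\<lambda>x. ereal (p x))"
      by (intro esssup_AE_mono) simp
    then show "z \<le> esssup (lebesgue_on {0..1}) (\<lambda>x. ereal (p x))"
      by (subst (asm) esssup_const) (simp_all add: emeasure_restrict_space)
  qed
  have "char_norm_estimate p"
    using meas _ blo by (rule char_norm_estimate_if_BLO_inv_log[where P = 4]) (use p in \<open>smt (verit)\<close>)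
  moreover have "\<not> char_norm_estimate (conj_exp p)"
    unfolding conj f_def using stair_steep
    by (intro stair.steep_profile_not_char_norm_estimate) auto
  moreover have "\<forall>x\<in>{0..1}. 1 \<le> p x" using p(1) by (smt (verit))
  moreover have "esssup (lebesgue_on {0..1}) (\<lambda>x. ereal (p x)) < \<infinity>"
    using sup by (rule le_less_trans) simp
  ultimately show ?thesis using meas blo inf le by blast
qed

end
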